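(* For any positive integers $n,k$ with $n>k$, there exists a system of $n$ polynomials with real coefficients in $n$ variables, $f_1(x_1,\ldots,x_n)=\cdots=f_n(x_1,\ldots,x_n)=0$, which involves in total $n+k+1$ distinct monomials and has exactly $\left\lfloor \frac{n+k}{k}\right\rfloor^k$ nondegenerate positive solutions.
   Context: The monomials involved in the system are the distinct monomials $x^a=x_1^{a_1}\cdots x_n^{a_n}$ (the constant monomial $1$ included) that appear with nonzero coefficient in at least one of the polynomials $f_1,\ldots,f_n$; their total number is counted across the whole system. A positive solution is a common zero of $f_1,\ldots,f_n$ in the open positive orthant $\mathbb{R}^n_>=\{x\in\mathbb{R}^n \mid x_i>0 \text{ for all } i\}$. A solution is nondegenerate if the Jacobian matrix $(\partial f_i/\partial x_j)_{i,j}$ is invertible at that point. *)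

theory Defs
  imports "HOL-Analysis.Analysis" "HOL-Library.Poly_Mapping"
begin

text \<open>
  Multivariate polynomials with real coefficients in variables indexed by \<^typ>\<open>'n\<close>: finitely
  supported maps from exponent vectors \<^typ>\<open>'n \<Rightarrow>\<^sub>0 nat\<close> to coefficients. The exponent
  vector \<open>0\<close> is the constant monomial.
\<close>

type_synonym 'n rpoly = "('n \<Rightarrow>\<^sub>0 nat) \<Rightarrow>\<^sub>0 real"

definition monom_eval :: "('n::finite \<Rightarrow>\<^sub>0 nat) \<Rightarrow> real ^ 'n \<Rightarrow> real" where
  "monom_eval a x = (\<Prod>i\<in>UNIV. (x $ i) ^ Poly_Mapping.lookup a i)"

definition poly_eval :: "('n::finite) rpoly \<Rightarrow> real ^ 'n \<Rightarrow> real" where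
  "poly_eval p x = (\<Sum>a\<in>Poly_Mapping.keys p. Poly_Mapping.lookup p a * monom_eval a x)"

text \<open>A square system assigns to each index in \<^typ>\<open>'n\<close> a polynomial in the variables \<^typ>\<open>'n\<close>.\<close>

definition system_monomials :: "('n::finite \<Rightarrow> 'n rpoly) \<Rightarrow> ('n \<Rightarrow>\<^sub>0 nat) set" where
  "system_monomials f = (\<Union>i. Poly_Mapping.keys (f i))"

definition system_map :: "('n::finite \<Rightarrow> 'n rpoly) \<Rightarrow> real ^ 'n \<Rightarrow> real ^ 'n" where
  "system_map f x = (\<chi> i. poly_eval (f i) x)"

definition positive_solution :: "('n::finite \<Rightarrow> 'n rpoly) \<Rightarrow> real ^ 'n \<Rightarrow> bool" where
  "positive_solution f x \<longleftrightarrow> (\<forall>i. x $ i > 0) \<and> (\<forall>i. poly_eval (f i) x = 0)"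

definition nondegenerate :: "('n::finite \<Rightarrow> 'n rpoly) \<Rightarrow> real ^ 'n \<Rightarrow> bool" where
  "nondegenerate f x \<longleftrightarrow> invertible (jacobian (system_map f) (at x))"

text \<open>
  \<^const>\<open>jacobian\<close> is only meaningful at points of differentiability; polynomial maps are
  differentiable everywhere.
\<close>

lemma differentiable_vec_nth:
  "(\<lambda>x::real ^ 'n. x $ i) differentiable at x"
  by (rule bounded_linear_imp_differentiable) (rule bounded_linear_vec_nth)

lemma poly_eval_differentiable: "poly_eval p differentiable at x"
proof -
  have prod: "(\<lambda>x. \<Prod>i\<in>I. (x $ i) ^ e i) differentiable at x" if "finite I"
    for I :: "'a set" and e :: "'a \<Rightarrow> nat" and x :: "real ^ 'a"
    using that
  proof (induction I rule: finite_induct)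
    case (insert j I)
    have "(\<lambda>x. (x $ j) ^ e j * (\<Prod>i\<in>I. (x $ i) ^ e i)) differentiable at x"
      by (intro differentiable_mult differentiable_power differentiable_vec_nth insert.IH)
    with insert.hyps show ?case by simp
  qed simp
  show ?thesis
    unfolding poly_eval_def[abs_def] monom_eval_def
    by (intro differentiable_sum ballI differentiable_mult prod differentiable_const finite_keys finite)
qed

lemma system_map_differentiable: "system_map f differentiable at x"
proof -
  have "((\<lambda>y. poly_eval (f i) y) has_derivative frechet_derivative (poly_eval (f i)) (at x)) (at x)" for i
    using poly_eval_differentiable frechet_derivative_works by blast
  then have "(system_map f has_derivative
      (\<lambda>h. \<chi> i. frechet_derivative (poly_eval (f i)) (at x) h)) (at x)"
    unfolding system_map_def[abs_def]
    by (subst has_derivative_componentwise_within) (auto simp: Basis_vec_def inner_axis)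
  then show ?thesis
    unfolding differentiable_def by blast
qed

text \<open>Hence the entries of the Jacobian are the partial derivatives.\<close>

lemma jacobian_system_map_nth:
  "((\<lambda>t. poly_eval (f i) (x + t *\<^sub>R axis j 1)) has_real_derivative
     jacobian (system_map f) (at x) $ i $ j) (at 0)"
proof -
  let ?J = "jacobian (system_map f) (at x)"
  have "(system_map f has_derivative (\<lambda>h. ?J *v h)) (at (x + 0 *\<^sub>R axis j 1))"
    using system_map_differentiable[of f x] by (simp add: jacobian_works)
  moreover have "((\<lambda>t::real. x + t *\<^sub>R axis j 1) has_derivative (\<lambda>t. t *\<^sub>R axis j 1)) (at 0)"
    by (auto intro!: derivative_eq_intros)
  ultimately have "((\<lambda>t::real. system_map f (x + t *\<^sub>R axis j 1)) has_derivative
      (\<lambda>t. ?J *v (t *\<^sub>R axis j 1))) (at 0)"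
    by (rule has_derivative_compose[rotated])
  from bounded_linear.has_derivative[OF bounded_linear_vec_nth[of i] this]
  have "((\<lambda>t. poly_eval (f i) (x + t *\<^sub>R axis j 1)) has_derivative
      (\<lambda>t. (?J *v (t *\<^sub>R axis j 1)) $ i)) (at 0)"
    by (simp only: system_map_def vec_lambda_beta)
  moreover have "(?J *v (t *\<^sub>R axis j 1)) $ i = ?J $ i $ j * t" for t
    by (simp only: matrix_vector_mult_scaleR matrix_vector_mult_basis)
      (simp only: column_def vector_scaleR_component vec_lambda_beta real_scaleR_def mult.commute)
  ultimately show ?thesis
    by (simp only: has_field_derivative_def)
qed

end

theory Submission
  imports Defs
begin

text \<open>
  Let \<open>m = n div k\<close>, and pick \<open>k\<close> disjoint chains of \<open>m\<close> variables each. A chain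
  \<open>x\<^sub>0, \<dots>, x\<^bsub>m-1\<^esub>\<close> carries the \<open>m\<close> equations
  \<open>x\<^sub>p x\<^bsub>p+1\<^esub> = 1 + c\<^sub>p x\<^sub>0\<^sup>2\<close>, with \<open>x\<^sub>m\<close> read as \<open>1\<close>, and every variable outside the
  chains is set equal to \<open>1\<close>. The monomials are one left-hand side per variable, one square \<open>x\<^sub>0\<^sup>2\<close>
  per chain and the common constant: \<open>n + k + 1\<close> in total. The chains do not interact, so the
  positive solutions are the \<open>k\<close>-tuples of positive solutions of a single chain, and it remains to
  find coefficients \<open>c\<^sub>p > 0\<close> for which a chain has exactly \<open>m + 1 = (n + k) div k\<close> of them, all
  nondegenerate.

  Eliminating from the far end, \<open>s = x\<^sub>0\<close> determines all of a chain: \<open>x\<^sub>p\<close> is an alternating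
  quotient of the factors \<open>1 + c\<^sub>p s\<^sup>2, 1 + c\<^bsub>p+1\<^esub> s\<^sup>2, \<dots>\<close>. What is left is the equation
  \<open>alt_quotient cs s = s\<close>, whose polynomial form, the eliminant, has degree \<open>m + 1\<close>. The coefficients
  are chosen one at a time (\<open>exists_alternating_eliminant\<close>): a new last coefficient \<open>e\<close> perturbs
  the eliminant by a multiple of \<open>e\<close>, so for small \<open>e\<close> it preserves the alternating signs found
  so far at finitely many points, but it raises the degree and reverses the sign at infinity, which
  yields one more sign change. In this way the eliminant gets \<open>m + 1\<close> sign changes on the positive
  axis; as this is its degree, it has exactly \<open>m + 1\<close> positive roots, all simple.

  Simplicity of the roots gives nondegeneracy: a vector in the kernel of the Jacobian is, on each
  chain, a multiple \<open>w\<close> of the velocity of the curve \<open>s \<mapsto> (x\<^sub>0, \<dots>, x\<^bsub>m-1\<^esub>)\<close> obtained by the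
  elimination, and comparing the entries at \<open>x\<^sub>0\<close> gives \<open>w = w \<cdot> deriv (alt_quotient cs) s\<close>; at a
  simple root that derivative differs from \<open>1\<close>.
\<close>

section \<open>Real polynomials with alternating signs\<close>

text \<open>
  Each of the \<open>N\<close> sign changes contributes a root, and these roots exhaust the degree: there is room
  neither for a further root nor for a multiple one.
\<close>

lemma alternating_signs_simple_roots:
  fixes p :: "real poly" and t :: "nat \<Rightarrow> real"
  assumes incr: "\<And>i. i < N \<Longrightarrow> t i < t (Suc i)"
    and alt: "\<And>i. i \<le> N \<Longrightarrow> 0 < (-1) ^ i * poly p (t i)"
    and deg: "degree p \<le> N"
  shows "card {x. t 0 < x \<and> poly p x = 0} = N"
    and "\<And>x. poly p x = 0 \<Longrightarrow> poly (pderiv p) x \<noteq> 0"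
proof -
  have p0: "p \<noteq> 0" using alt[of 0] by auto
  have "\<exists>x. t i < x \<and> x < t (Suc i) \<and> poly p x = 0" if "i < N" for i
  proof -
    have "0 < ((-1) ^ i * poly p (t i)) * ((-1) ^ Suc i * poly p (t (Suc i)))"
      using alt[of i] alt[of "Suc i"] that by (simp only: mult_pos_pos less_imp_le_nat Suc_leI)
    also have "\<dots> = - (poly p (t i) * poly p (t (Suc i))) * ((-1) ^ i * (-1) ^ i)"
      by (simp add: algebra_simps)
    also have "\<dots> = - (poly p (t i) * poly p (t (Suc i)))"
      by (simp flip: power_mult_distrib)
    finally show ?thesis using poly_IVT[OF incr[OF that], of p] by auto
  qed
  then obtain r where r: "\<And>i. i < N \<Longrightarrow> t i < r i \<and> r i < t (Suc i) \<and> poly p (r i) = 0"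
    by metis
  have t_mono: "t i \<le> t j" if "i \<le> j" "j \<le> N" for i j
    using that
  proof (induction rule: dec_induct)
    case (step j)
    then show ?case using incr[of j] by simp
  qed simp
  have r_less: "r i < r j" if "i < j" "j < N" for i j
    using r[of i] r[of j] t_mono[of "Suc i" j] that by fastforce
  have "inj_on r {..<N}"
    by (rule linorder_inj_onI') (use r_less in \<open>simp add: less_imp_neq\<close>)
  then have card_r: "card (r ` {..<N}) = N"
    by (simp add: card_image)
  have "t 0 < r i" if "i < N" for i
    using r[OF that] t_mono[of 0 i] that by linarith
  then have r_sub: "r ` {..<N} \<subseteq> {x. t 0 < x \<and> poly p x = 0}"
    using r by auto
  have fin: "finite {x. poly p x = 0}" by (rule poly_roots_finite[OF p0])
  have "card {x. t 0 < x \<and> poly p x = 0} \<le> card {x. poly p x = 0}"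
    by (rule card_mono[OF fin]) auto
  also have "\<dots> \<le> N" using card_poly_roots_bound[OF p0] deg by linarith
  moreover have "N \<le> card {x. t 0 < x \<and> poly p x = 0}"
    using card_mono[OF _ r_sub] card_r finite_subset[OF _ fin] by auto
  ultimately show "card {x. t 0 < x \<and> poly p x = 0} = N" by linarith
  show "poly (pderiv p) x \<noteq> 0" if root: "poly p x = 0" for x
  proof
    assume double: "poly (pderiv p) x = 0"
    from root obtain q where q: "p = [:- x, 1:] * q"
      by (metis poly_eq_0_iff_dvd dvd_def)
    have "q \<noteq> 0" using q p0 by auto
    have deg_p: "degree p = Suc (degree q)"
      using \<open>q \<noteq> 0\<close> by (simp add: q degree_mult_eq del: mult_pCons_left)
    have "poly q x = 0"
      using double by (simp add: q pderiv_mult pderiv_pCons del: mult_pCons_left)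
    \<comment> \<open>With a double root at \<open>x\<close>, the quotient \<open>q\<close> keeps all the roots of \<open>p\<close> but has smaller degree.\<close>
    then have "{y. poly p y = 0} \<subseteq> {y. poly q y = 0}"
      using q by auto
    then have "r ` {..<N} \<subseteq> {y. poly q y = 0}" using r_sub by auto
    then have "N \<le> card {y. poly q y = 0}"
      using card_mono[OF poly_roots_finite[OF \<open>q \<noteq> 0\<close>]] card_r by metis
    then show False
      using card_poly_roots_bound[OF \<open>q \<noteq> 0\<close>] deg deg_p by linarith
  qed
qed


section \<open>The eliminant of a chain\<close>

text \<open>
  \<open>alt_num [c\<^sub>0, c\<^sub>1, c\<^sub>2, \<dots>]\<close> is \<open>(1 + c\<^sub>0 s\<^sup>2) (1 + c\<^sub>2 s\<^sup>2) (1 + c\<^sub>4 s\<^sup>2) \<cdots>\<close>. The coefficients at odd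
  positions are those at even positions of the tail, so \<open>alt_quotient\<close> below is
  \<open>(1 + c\<^sub>0 s\<^sup>2) (1 + c\<^sub>2 s\<^sup>2) \<cdots> / ((1 + c\<^sub>1 s\<^sup>2) (1 + c\<^sub>3 s\<^sup>2) \<cdots>)\<close>: the value that a chain forces on its
  first variable when the square of that variable is \<open>s\<^sup>2\<close>.
\<close>

fun alt_num :: "real list \<Rightarrow> real poly" where
  "alt_num [] = 1"
| "alt_num (c # cs) = [:1, 0, c:] * alt_num (tl cs)"

definition alt_quotient :: "real list \<Rightarrow> real \<Rightarrow> real" where
  "alt_quotient cs s = poly (alt_num cs) s / poly (alt_num (tl cs)) s"

definition eliminant :: "real list \<Rightarrow> real poly" where
  "eliminant cs = alt_num cs - pCons 0 (alt_num (tl cs))"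

lemma pos_tl: "\<forall>c\<in>set cs. 0 < c \<Longrightarrow> \<forall>c\<in>set (tl cs). 0 < (c::real)"
  by (cases cs) auto

lemma alt_num_pos:
  assumes "\<forall>c\<in>set cs. 0 < c"
  shows "0 < poly (alt_num cs) s"
  using assms
proof (induction cs rule: alt_num.induct)
  case (2 c cs)
  have "0 < c" and "\<forall>c\<in>set cs. 0 < c" using 2(2) by simp_all
  then have "0 < poly (alt_num (tl cs)) s" using 2(1)[OF pos_tl] by simp
  moreover have "0 < poly [:1, 0, c:] s"
    using \<open>0 < c\<close> mult_nonneg_nonneg[of "s * s" c] by (simp add: mult.assoc)
  ultimately show ?case by (simp only: alt_num.simps poly_mult mult_pos_pos)
qed simp

lemma degree_lead_coeff_alt_num:
  assumes "\<forall>c\<in>set cs. 0 < c"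
  shows "degree (alt_num cs) = 2 * (Suc (length cs) div 2) \<and> 0 < lead_coeff (alt_num cs)"
  using assms
proof (induction cs rule: alt_num.induct)
  case (2 c cs)
  have c: "0 < c" and tl: "\<forall>c\<in>set (tl cs). 0 < c"
    using 2(2) pos_tl[of cs] by simp_all
  note IH = 2(1)[OF tl]
  then have "alt_num (tl cs) \<noteq> 0" by auto
  moreover have "[:1, 0, c:] \<noteq> 0" "degree [:1, 0, c:] = 2" using c by auto
  ultimately have "degree (alt_num (c # cs)) = 2 + degree (alt_num (tl cs))"
    using degree_mult_eq by (metis alt_num.simps(2))
  moreover have "lead_coeff (alt_num (c # cs)) = c * lead_coeff (alt_num (tl cs))"
    using c by (simp only: alt_num.simps lead_coeff_mult) simp
  ultimately show ?case using IH c by (cases cs) auto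
qed simp

text \<open>
  The two parts of the eliminant have degrees of opposite parity, so they cannot cancel. The numerator
  dominates for odd length and the subtracted denominator for even length; hence the alternating sign
  of the leading coefficient.
\<close>

lemma degree_lead_coeff_eliminant:
  assumes "\<forall>c\<in>set cs. 0 < c"
  shows "degree (eliminant cs) = Suc (length cs)"
    and "0 < (-1) ^ Suc (length cs) * lead_coeff (eliminant cs)"
proof -
  let ?N = "alt_num cs" and ?D = "pCons 0 (alt_num (tl cs))"
  have N: "degree ?N = 2 * (Suc (length cs) div 2)" "0 < lead_coeff ?N"
    using degree_lead_coeff_alt_num[OF assms] by auto
  have D: "degree ?D = Suc (2 * (Suc (length cs - 1) div 2))" "0 < lead_coeff ?D"
    using degree_lead_coeff_alt_num[OF pos_tl[OF assms]]
    by (auto simp: degree_pCons_eq)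
  have "degree (eliminant cs) = Suc (length cs) \<and>
        0 < (-1) ^ Suc (length cs) * lead_coeff (eliminant cs)"
  proof (cases "even (length cs)")
    case True
    then have len: "2 * (Suc (length cs) div 2) = length cs" "2 * (Suc (length cs - 1) div 2) = length cs"
      by (cases cs; simp)+
    then have "degree ?N < degree ?D" "degree ?D = Suc (length cs)"
      using N(1) D(1) len by presburger+
    moreover have "degree (eliminant cs) = degree ?D"
      using calculation degree_add_eq_right[of ?N "- ?D"]
      by (simp only: eliminant_def diff_conv_add_uminus degree_minus)
    ultimately show ?thesis
      using D(2) True coeff_eq_0[of ?N "degree ?D"]
      by (simp only: eliminant_def coeff_diff) simp
  next
    case False
    then have len: "2 * (Suc (length cs) div 2) = Suc (length cs)"
        "Suc (2 * (Suc (length cs - 1) div 2)) = length cs"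
      by (cases cs; simp)+
    then have "degree ?D < degree ?N" "degree ?N = Suc (length cs)"
      using N(1) D(1) len by presburger+
    moreover have "degree (eliminant cs) = degree ?N"
      using calculation degree_add_eq_left[of "- ?D" ?N]
      by (simp only: eliminant_def diff_conv_add_uminus degree_minus)
    ultimately show ?thesis
      using N(2) False coeff_eq_0[of ?D "degree ?N"]
      by (simp only: eliminant_def coeff_diff) simp
  qed
  then show "degree (eliminant cs) = Suc (length cs)"
    and "0 < (-1) ^ Suc (length cs) * lead_coeff (eliminant cs)" by auto
qed

text \<open>
  An appended coefficient enters the numerator or the denominator, according to the parity of its
  position.
\<close>

lemma alt_num_snoc:
  "alt_num (cs @ [e]) = alt_num cs * (if even (length cs) then [:1, 0, e:] else 1)"
proof (induction cs rule: alt_num.induct)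
  case (2 c cs)
  show ?case
  proof (cases cs)
    case (Cons d ds)
    have "alt_num ((c # cs) @ [e]) = [:1, 0, c:] * alt_num (tl cs @ [e])"
      by (simp only: Cons append.simps alt_num.simps list.sel)
    also have "\<dots> = alt_num (c # cs) * (if even (length (tl cs)) then [:1, 0, e:] else 1)"
      by (simp only: 2 alt_num.simps mult.assoc)
    also have "even (length (tl cs)) = even (length (c # cs))"
      by (simp add: Cons)
    finally show ?thesis .
  qed simp
qed simp

text \<open>
  As a function of its last coefficient \<open>e\<close>, the eliminant at a fixed point is affine, and at
  \<open>e = 0\<close> it is the eliminant of the shorter list. This is why coefficients are appended at the far
  end: a small coefficient in front of the list would instead invert the quotient.
\<close>

lemma eliminant_snoc:
  "poly (eliminant (cs @ [e])) s = poly (eliminant cs) s + e *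
     (if even (length cs) then s\<^sup>2 * poly (alt_num cs) s else - (s ^ 3 * poly (alt_num (tl cs)) s))"
proof (cases cs)
  case Nil
  then show ?thesis by (simp add: eliminant_def power2_eq_square algebra_simps)
next
  case (Cons c ds)
  have "poly (alt_num (ds @ [e])) s = poly (alt_num ds) s * (if even (length ds) then 1 + s * (s * e) else 1)"
    by (simp only: alt_num_snoc poly_mult) simp
  moreover have "poly (alt_num (cs @ [e])) s = poly (alt_num cs) s * (if even (length cs) then 1 + s * (s * e) else 1)"
    by (simp only: alt_num_snoc poly_mult) simp
  ultimately show ?thesis
    using Cons unfolding eliminant_def
    by (simp add: algebra_simps power2_eq_square power3_eq_cube del: alt_num.simps)
qed

text \<open>
  The induction keeps the old sample points and adds one far to the right. The points start at
  \<open>0\<close>, where every eliminant has the value \<open>1\<close>, so the roots between them are positive.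
\<close>

lemma exists_alternating_eliminant:
  "\<exists>cs t. length cs = m \<and> (\<forall>c\<in>set cs. 0 < c) \<and> t 0 = 0 \<and> (\<forall>i\<le>m. t i < t (Suc i)) \<and>
     (\<forall>i\<le>Suc m. 0 < (-1) ^ i * poly (eliminant cs) (t i))"
proof (induction m)
  case 0
  show ?case
    by (rule exI[of _ "[]"], rule exI[of _ "\<lambda>i. 2 * real i"])
      (auto simp: eliminant_def le_Suc_eq)
next
  case (Suc m)
  then obtain cs t where cs: "length cs = m" "\<forall>c\<in>set cs. 0 < c"
    and t: "t 0 = 0" "\<And>i. i \<le> m \<Longrightarrow> t i < t (Suc i)"
    and alt: "\<And>i. i \<le> Suc m \<Longrightarrow> 0 < (-1) ^ i * poly (eliminant cs) (t i)"
    by auto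
  \<comment> \<open>Finitely many strict inequalities survive a small change of the last coefficient.\<close>
  have "\<forall>\<^sub>F e in at_right 0. 0 < (-1) ^ i * poly (eliminant (cs @ [e])) (t i)"
    if "i \<le> Suc m" for i
  proof -
    have "((\<lambda>e. (-1) ^ i * poly (eliminant (cs @ [e])) (t i)) \<longlongrightarrow>
        (-1) ^ i * poly (eliminant cs) (t i)) (at_right 0)"
      unfolding eliminant_snoc by (auto intro!: tendsto_eq_intros)
    then show ?thesis using alt[OF that] by (rule order_tendstoD)
  qed
  then have "\<forall>\<^sub>F e in at_right 0. \<forall>i\<in>{..Suc m}. 0 < (-1) ^ i * poly (eliminant (cs @ [e])) (t i)"
    by (intro eventually_ball_finite) auto
  then have "\<forall>\<^sub>F e in at_right 0. 0 < e \<and>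
      (\<forall>i\<in>{..Suc m}. 0 < (-1) ^ i * poly (eliminant (cs @ [e])) (t i))"
    using eventually_at_right_less[of "0::real"] by eventually_elim auto
  then obtain e :: real where e: "0 < e"
    "\<And>i. i \<le> Suc m \<Longrightarrow> 0 < (-1) ^ i * poly (eliminant (cs @ [e])) (t i)"
    using eventually_happens'[OF trivial_limit_at_right_real] by (force simp: atMost_iff)
  let ?cs = "cs @ [e]"
  have pos: "\<forall>c\<in>set ?cs. 0 < c" using cs e by auto
  \<comment> \<open>The leading coefficient of the new eliminant has the sign required at sample point \<open>m + 2\<close>.\<close>
  let ?q = "smult ((-1) ^ Suc (Suc m)) (eliminant ?cs)"
  have "0 < lead_coeff ?q"
    using degree_lead_coeff_eliminant(2)[OF pos] cs(1) by simp
  from poly_pinfty_gt_lc[OF this] obtain u where u: "\<And>x. u \<le> x \<Longrightarrow> 0 < poly ?q x"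
    using \<open>0 < lead_coeff ?q\<close> by (meson less_le_trans)
  define t' where "t' = t(Suc (Suc m) := max u (t (Suc m) + 1))"
  have "\<forall>i\<le>Suc m. t' i < t' (Suc i)"
    using t(2) by (auto simp: t'_def le_Suc_eq)
  moreover have "\<forall>i\<le>Suc (Suc m). 0 < (-1) ^ i * poly (eliminant ?cs) (t' i)"
  proof (intro allI impI)
    fix i assume i: "i \<le> Suc (Suc m)"
    show "0 < (-1) ^ i * poly (eliminant ?cs) (t' i)"
    proof (cases "i = Suc (Suc m)")
      case True
      then show ?thesis using u[of "t' i"] by (simp add: t'_def)
    next
      case False
      then show ?thesis using e(2)[of i] i by (simp add: t'_def)
    qed
  qed
  moreover have "t' 0 = 0" using t(1) by (simp add: t'_def)
  moreover have "length ?cs = Suc m" using cs by simp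
  ultimately show ?case using pos by blast
qed

lemma alt_quotient_pos:
  assumes "\<forall>c\<in>set cs. 0 < c"
  shows "0 < alt_quotient cs s"
  unfolding alt_quotient_def using alt_num_pos[OF assms] alt_num_pos[OF pos_tl[OF assms]] by simp

lemma alt_quotient_Nil [simp]: "alt_quotient [] s = 1"
  by (simp add: alt_quotient_def)

text \<open>
  This is one equation of the chain, for consecutive values of the elimination.
\<close>

lemma alt_quotient_Cons_mult:
  assumes "\<forall>c\<in>set cs. 0 < c"
  shows "alt_quotient (c # cs) s * alt_quotient cs s = 1 + c * s\<^sup>2"
proof -
  have "poly (alt_num (c # cs)) s = (1 + c * s\<^sup>2) * poly (alt_num (tl cs)) s"
    by (simp only: alt_num.simps poly_mult) (simp add: power2_eq_square mult_ac)
  then show ?thesis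
    using alt_num_pos[OF assms, of s] alt_num_pos[OF pos_tl[OF assms], of s]
    by (simp add: alt_quotient_def field_simps del: alt_num.simps)
qed

lemma poly_eliminant:
  assumes "\<forall>c\<in>set cs. 0 < c"
  shows "poly (eliminant cs) s = poly (alt_num (tl cs)) s * (alt_quotient cs s - s)"
  using alt_num_pos[OF pos_tl[OF assms], of s]
  by (simp add: eliminant_def alt_quotient_def field_simps)

lemma alt_quotient_differentiable:
  assumes "\<forall>c\<in>set cs. 0 < c"
  shows "(alt_quotient cs has_real_derivative deriv (alt_quotient cs) s) (at s)"
proof -
  have "poly p field_differentiable (at s)" for p :: "real poly"
    using poly_DERIV field_differentiable_def by blast
  then have "alt_quotient cs field_differentiable (at s)"
    unfolding alt_quotient_def[abs_def]
    by (intro field_differentiable_divide)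
      (use alt_num_pos[OF pos_tl[OF assms], of s] in auto)
  then show ?thesis by (simp add: DERIV_deriv_iff_field_differentiable)
qed

lemma deriv_alt_quotient_Cons:
  assumes "\<forall>d\<in>set (c # cs). 0 < d"
  shows "deriv (alt_quotient (c # cs)) s * alt_quotient cs s
    + alt_quotient (c # cs) s * deriv (alt_quotient cs) s = 2 * c * s"
proof -
  have pos: "\<forall>d\<in>set cs. 0 < d" using assms by simp
  have "((\<lambda>s. alt_quotient (c # cs) s * alt_quotient cs s) has_real_derivative
      deriv (alt_quotient (c # cs)) s * alt_quotient cs s
      + deriv (alt_quotient cs) s * alt_quotient (c # cs) s) (at s)"
    by (intro DERIV_mult alt_quotient_differentiable assms pos)
  moreover have "((\<lambda>s. alt_quotient (c # cs) s * alt_quotient cs s) has_real_derivative 2 * c * s) (at s)"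
    unfolding alt_quotient_Cons_mult[OF pos] by (auto intro!: derivative_eq_intros)
  ultimately show ?thesis
    by (metis DERIV_unique mult.commute)
qed

text \<open>
  The analytic core: one chain of length \<open>m\<close> can have \<open>m + 1\<close> positive solutions. The condition on
  the derivative expresses that the corresponding roots of the eliminant are simple.
\<close>

lemma exists_chain_coefficients:
  "\<exists>cs. length cs = m \<and> (\<forall>c\<in>set cs. 0 < c) \<and>
     card {s. 0 < s \<and> alt_quotient cs s = s} = Suc m \<and>
     (\<forall>s. alt_quotient cs s = s \<longrightarrow> deriv (alt_quotient cs) s \<noteq> 1)"
proof -
  obtain cs t where cs: "length cs = m" and pos: "\<forall>c\<in>set cs. 0 < c" and t: "t 0 = 0"
      "\<And>i. i \<le> m \<Longrightarrow> t i < t (Suc i)"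
    and alt: "\<And>i. i \<le> Suc m \<Longrightarrow> 0 < (-1) ^ i * poly (eliminant cs) (t i)"
    using exists_alternating_eliminant[of m] by blast
  have deg: "degree (eliminant cs) \<le> Suc m"
    using degree_lead_coeff_eliminant(1)[OF pos] cs by simp
  have root_iff: "poly (eliminant cs) s = 0 \<longleftrightarrow> alt_quotient cs s = s" for s
    using alt_num_pos[OF pos_tl[OF pos], of s] by (simp add: poly_eliminant[OF pos])
  have incr: "\<And>i. i < Suc m \<Longrightarrow> t i < t (Suc i)" using t(2) by simp
  note roots = alternating_signs_simple_roots[OF incr alt deg]
  have "deriv (alt_quotient cs) s \<noteq> 1" if fp: "alt_quotient cs s = s" for s
  proof
    assume d: "deriv (alt_quotient cs) s = 1"
    \<comment> \<open>At a fixed point, derivative \<open>1\<close> would make \<open>s\<close> a multiple root of the eliminant.\<close>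
    have "((\<lambda>s. poly (alt_num (tl cs)) s * (alt_quotient cs s - s)) has_real_derivative 0) (at s)"
      by (rule derivative_eq_intros poly_DERIV alt_quotient_differentiable[OF pos] refl)+
        (simp add: fp d)
    then have "(poly (eliminant cs) has_real_derivative 0) (at s)"
      by (simp only: poly_eliminant[OF pos, abs_def])
    then have "poly (pderiv (eliminant cs)) s = 0"
      using DERIV_unique poly_DERIV by blast
    then show False using roots(2)[of s] fp root_iff by simp
  qed
  then show ?thesis
    using cs pos roots(1) by (auto simp: t(1) root_iff)
qed

text \<open>
  Back-substitution: starting from the value \<open>1\<close> beyond the end, the equations determine a chain from
  the number \<open>s\<close> on their right-hand sides. In the application \<open>s\<close> is \<open>y 0\<close> itself, and the case
  \<open>p = 0\<close> becomes the fixed point equation.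
\<close>

lemma alt_quotient_chain:
  assumes pos: "\<forall>c\<in>set cs. 0 < c"
    and last: "y (length cs) = 1"
    and link: "\<And>p. p < length cs \<Longrightarrow> y p * y (Suc p) = 1 + cs ! p * s\<^sup>2"
    and "p \<le> length cs"
  shows "y p = alt_quotient (drop p cs) s"
  using \<open>p \<le> length cs\<close>
proof (induction rule: inc_induct)
  case base
  then show ?case by (simp add: last)
next
  case (step p)
  have pos': "\<forall>c\<in>set (drop (Suc p) cs). 0 < c"
    using pos by (meson in_set_dropD)
  have "y p * alt_quotient (drop (Suc p) cs) s = 1 + cs ! p * s\<^sup>2"
    using link[of p] step by simp
  also have "\<dots> = alt_quotient (drop p cs) s * alt_quotient (drop (Suc p) cs) s"
    using alt_quotient_Cons_mult[OF pos'] step(2) by (metis Cons_nth_drop_Suc)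
  finally show ?case
    using alt_quotient_pos[OF pos', of s] by simp
qed

text \<open>
  The linearization of the previous lemma: the same back-substitution for the linearized equations,
  where \<open>w\<close> is the variation of \<open>s\<close>.
\<close>

lemma alt_quotient_chain_tangent:
  assumes pos: "\<forall>c\<in>set cs. 0 < c"
    and last: "v (length cs) = 0"
    and link: "\<And>p. p < length cs \<Longrightarrow> v p * alt_quotient (drop (Suc p) cs) s
      + alt_quotient (drop p cs) s * v (Suc p) = 2 * cs ! p * s * w"
    and "p \<le> length cs"
  shows "v p = w * deriv (alt_quotient (drop p cs)) s"
  using \<open>p \<le> length cs\<close>
proof (induction rule: inc_induct)
  case base
  have "alt_quotient [] = (\<lambda>s. 1)" by auto
  then show ?case by (simp add: last)
next
  case (step p)
  let ?G = "\<lambda>p. alt_quotient (drop p cs)"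
  have pos': "\<forall>c\<in>set (drop q cs). 0 < c" for q
    using pos by (meson in_set_dropD)
  have "deriv (?G p) s * ?G (Suc p) s + ?G p s * deriv (?G (Suc p)) s = 2 * cs ! p * s"
    using deriv_alt_quotient_Cons[of "cs ! p" "drop (Suc p) cs" s] pos'[of p] step(2)
    by (simp add: Cons_nth_drop_Suc)
  then have "w * (deriv (?G p) s * ?G (Suc p) s + ?G p s * deriv (?G (Suc p)) s)
      = v p * ?G (Suc p) s + ?G p s * v (Suc p)"
    using link[OF step(2)] by (simp add: mult_ac)
  then have "w * deriv (?G p) s * ?G (Suc p) s = v p * ?G (Suc p) s"
    by (simp add: step(3) algebra_simps)
  then show ?case
    using alt_quotient_pos[OF pos'[of "Suc p"], of s] by simp
qed


section \<open>Evaluation of sparse polynomials\<close>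

lemma monom_eval_zero [simp]: "monom_eval 0 x = 1"
  by (simp add: monom_eval_def)

lemma monom_eval_single [simp]: "monom_eval (Poly_Mapping.single i e) x = (x $ i) ^ e"
proof -
  have "monom_eval (Poly_Mapping.single i e) x = (\<Prod>j\<in>UNIV. if j = i then (x $ i) ^ e else 1)"
    unfolding monom_eval_def by (rule prod.cong) (auto simp: lookup_single when_def)
  then show ?thesis by simp
qed

lemma monom_eval_add [simp]: "monom_eval (a + b) x = monom_eval a x * monom_eval b x"
  by (simp add: monom_eval_def lookup_add power_add prod.distrib)

lemma poly_eval_superset:
  assumes "finite A" "Poly_Mapping.keys p \<subseteq> A"
  shows "poly_eval p x = (\<Sum>a\<in>A. Poly_Mapping.lookup p a * monom_eval a x)"
  unfolding poly_eval_def using assms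
  by (intro sum.mono_neutral_left) (auto simp: in_keys_iff)

lemma poly_eval_diff [simp]: "poly_eval (p - q) x = poly_eval p x - poly_eval q x"
proof -
  let ?A = "Poly_Mapping.keys p \<union> Poly_Mapping.keys q"
  have "Poly_Mapping.keys (p - q) \<subseteq> ?A" by (rule keys_diff)
  then show ?thesis
    by (simp add: poly_eval_superset[of ?A] lookup_minus left_diff_distrib sum_subtractf)
qed

lemma poly_eval_single [simp]: "poly_eval (Poly_Mapping.single a c) x = c * monom_eval a x"
  by (simp add: poly_eval_superset[of "{a}"])

lemma poly_eval_one [simp]: "poly_eval 1 x = 1"
  using poly_eval_single[of 0 1 x] by simp


section \<open>Disjoint chains\<close>

text \<open>
  The equation \<open>x\<^sup>a = 1 + c x\<^sup>h\<close>. The value \<open>c = 0\<close> is allowed; it serves for the variables outside the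
  chains and makes the third monomial disappear.
\<close>

definition trinomial :: "('n \<Rightarrow>\<^sub>0 nat) \<Rightarrow> ('n \<Rightarrow>\<^sub>0 nat) \<Rightarrow> real \<Rightarrow> 'n rpoly" where
  "trinomial a h c = Poly_Mapping.single a 1 - Poly_Mapping.single 0 1 - Poly_Mapping.single h c"

lemma keys_trinomial:
  assumes "a \<noteq> 0" "h \<noteq> 0" "a \<noteq> h"
  shows "Poly_Mapping.keys (trinomial a h c) = {a, 0} \<union> (if c = 0 then {} else {h})"
  using assms by (auto simp: in_keys_iff trinomial_def lookup_minus lookup_one lookup_single when_def split: if_splits)

text \<open>
  The variables are arranged in \<open>k\<close> chains of equal length: \<open>var b p\<close> is the variable at place \<open>p\<close> of
  chain \<open>b\<close>, with inverse given by \<open>block\<close> and \<open>place\<close>. A variable \<open>i\<close> with \<open>k \<le> block i\<close> belongs to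
  no chain. All chains use the same coefficients \<open>cs\<close>.
\<close>

locale chain_blocks =
  fixes k :: nat and cs :: "real list"
    and var :: "nat \<Rightarrow> nat \<Rightarrow> 'n::finite" and block place :: "'n \<Rightarrow> nat"
  assumes nonempty: "cs \<noteq> []" and pos: "\<forall>c\<in>set cs. 0 < c"
    and block_var: "\<And>b p. b < k \<Longrightarrow> p < length cs \<Longrightarrow> block (var b p) = b"
    and place_var: "\<And>b p. b < k \<Longrightarrow> p < length cs \<Longrightarrow> place (var b p) = p"
    and place_less: "\<And>i. block i < k \<Longrightarrow> place i < length cs"
    and var_block_place: "\<And>i. block i < k \<Longrightarrow> var (block i) (place i) = i"
begin

definition linked :: "'n \<Rightarrow> bool" where
  "linked i \<longleftrightarrow> block i < k \<and> Suc (place i) < length cs"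

definition succ :: "'n \<Rightarrow> 'n" where
  "succ i = var (block i) (Suc (place i))"

definition link_monom :: "'n \<Rightarrow> 'n \<Rightarrow>\<^sub>0 nat" where
  "link_monom i = Poly_Mapping.single i 1 + (if linked i then Poly_Mapping.single (succ i) 1 else 0)"

definition head_monom :: "nat \<Rightarrow> 'n \<Rightarrow>\<^sub>0 nat" where
  "head_monom b = Poly_Mapping.single (var b 0) 2"

definition coeff_at :: "'n \<Rightarrow> real" where
  "coeff_at i = (if block i < k then cs ! place i else 0)"

definition chain_system :: "'n \<Rightarrow> 'n rpoly" where
  "chain_system i = trinomial (link_monom i) (head_monom (block i)) (coeff_at i)"

lemma place_succ: "linked i \<Longrightarrow> place (succ i) = Suc (place i)"
  by (simp add: linked_def succ_def place_var)

lemma lookup_link_monom: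
  "Poly_Mapping.lookup (link_monom i) j = (if j = i \<or> linked i \<and> j = succ i then 1 else 0)"
  using place_succ[of i] by (auto simp: link_monom_def lookup_add lookup_single when_def)

lemma link_monom_nonzero: "link_monom i \<noteq> 0"
  using lookup_link_monom[of i i] by auto

lemma head_monom_nonzero: "head_monom b \<noteq> 0"
proof
  assume "head_monom b = 0"
  then have "Poly_Mapping.lookup (head_monom b) (var b 0) = 0" by simp
  then show False by (simp add: head_monom_def)
qed

lemma link_monom_neq_head_monom: "link_monom i \<noteq> head_monom b"
proof
  assume "link_monom i = head_monom b"
  then have "Poly_Mapping.lookup (link_monom i) (var b 0) = 2"
    by (simp add: head_monom_def)
  then show False by (simp add: lookup_link_monom split: if_splits)
qed

text \<open>
  Two variables with the same link monomial would each have to be the successor of the other, but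
  successors have a larger place.
\<close>

lemma inj_link_monom: "inj link_monom"
proof (rule injI, rule ccontr)
  fix i j assume eq: "link_monom i = link_monom j" and "i \<noteq> j"
  have "Poly_Mapping.lookup (link_monom j) i = 1" unfolding eq[symmetric] by (simp add: lookup_link_monom)
  moreover have "Poly_Mapping.lookup (link_monom i) j = 1" unfolding eq by (simp add: lookup_link_monom)
  ultimately have "linked j \<and> i = succ j" "linked i \<and> j = succ i"
    using \<open>i \<noteq> j\<close> lookup_link_monom by (metis zero_neq_one)+
  then have "place i = Suc (place j)" "place j = Suc (place i)" using place_succ by metis+
  then show False by simp
qed

lemma inj_head_monom: "inj_on head_monom {..<k}"
proof (rule inj_onI)
  fix b b' assume "b \<in> {..<k}" "b' \<in> {..<k}" and eq: "head_monom b = head_monom b'"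
  have "Poly_Mapping.lookup (head_monom b') (var b 0) = 2"
    unfolding eq[symmetric] by (simp add: head_monom_def)
  then have "var b 0 = var b' 0"
    by (simp add: head_monom_def lookup_single when_def split: if_splits)
  moreover have "block (var b 0) = b" "block (var b' 0) = b'"
    using block_var \<open>b \<in> _\<close> \<open>b' \<in> _\<close> nonempty by simp_all
  ultimately show "b = b'" by metis
qed

lemma coeff_at_eq_0_iff: "coeff_at i = 0 \<longleftrightarrow> k \<le> block i"
proof (cases "block i < k")
  case True
  then have "0 < cs ! place i" using pos place_less[of i] by simp
  with True show ?thesis by (simp add: coeff_at_def)
qed (simp add: coeff_at_def)

lemma system_monomials_chain_system:
  "system_monomials chain_system = insert 0 (range link_monom \<union> head_monom ` {..<k})"
proof -
  have "b \<in> block ` {i. block i < k}" if "b < k" for b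
    using block_var[of b 0] that nonempty by (intro image_eqI[of _ _ "var b 0"]) simp_all
  then have "{..<k} = block ` {i. block i < k}" by auto
  moreover have "Poly_Mapping.keys (chain_system i) = {link_monom i, 0} \<union> (if block i < k then {head_monom (block i)} else {})" for i
    unfolding chain_system_def
    by (subst keys_trinomial)
      (auto simp: link_monom_nonzero head_monom_nonzero link_monom_neq_head_monom coeff_at_eq_0_iff)
  ultimately show ?thesis
    unfolding system_monomials_def by (auto split: if_splits)
qed

lemma card_system_monomials: "card (system_monomials chain_system) = CARD('n) + k + 1"
proof -
  have "card (range link_monom \<union> head_monom ` {..<k}) = CARD('n) + k"
    using link_monom_neq_head_monom
    by (subst card_Un_disjoint) (auto simp: card_image inj_link_monom inj_head_monom)
  moreover have "0 \<notin> range link_monom \<union> head_monom ` {..<k}"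
    using link_monom_nonzero head_monom_nonzero by (metis UnE imageE)
  ultimately show ?thesis by (simp add: system_monomials_chain_system)
qed

definition next_coord :: "real ^ 'n \<Rightarrow> 'n \<Rightarrow> real" where
  "next_coord x i = (if linked i then x $ succ i else 1)"

lemma poly_eval_chain_system:
  "poly_eval (chain_system i) x
    = x $ i * next_coord x i - 1 - coeff_at i * (x $ var (block i) 0)\<^sup>2"
  by (cases "linked i")
    (simp_all add: chain_system_def trinomial_def link_monom_def head_monom_def next_coord_def)

lemma linked_var: "b < k \<Longrightarrow> p < length cs \<Longrightarrow> linked (var b p) \<longleftrightarrow> Suc p < length cs"
  by (simp add: linked_def block_var place_var)

lemma succ_var: "b < k \<Longrightarrow> p < length cs \<Longrightarrow> succ (var b p) = var b (Suc p)"
  by (simp add: succ_def block_var place_var)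

lemma coeff_at_var: "b < k \<Longrightarrow> p < length cs \<Longrightarrow> coeff_at (var b p) = cs ! p"
  by (simp add: coeff_at_def block_var place_var)

lemma block_cases:
  obtains (in_block) b p where "b < k" "p < length cs" "i = var b p" | (outside) "k \<le> block i"
  using place_less[of i] var_block_place[of i] by (metis not_le)

text \<open>
  The solved form of the system. The case \<open>p = 0\<close> says that the first variable of each chain is a
  fixed point of \<open>alt_quotient cs\<close>.
\<close>

lemma positive_solution_chain_system_iff:
  "positive_solution chain_system x \<longleftrightarrow>
    (\<forall>b<k. 0 < x $ var b 0 \<and> (\<forall>p<length cs. x $ var b p = alt_quotient (drop p cs) (x $ var b 0)))
    \<and> (\<forall>i. k \<le> block i \<longrightarrow> x $ i = 1)"
    (is "_ \<longleftrightarrow> ?blocks \<and> ?others")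
proof (intro iffI conjI)
  assume sol: "positive_solution chain_system x"
  then have eq: "x $ i * next_coord x i = 1 + coeff_at i * (x $ var (block i) 0)\<^sup>2" for i
    unfolding positive_solution_def poly_eval_chain_system by (simp add: algebra_simps)
  show ?blocks
  proof (intro allI impI conjI)
    fix b assume b: "b < k"
    show "0 < x $ var b 0" using sol by (simp add: positive_solution_def)
    fix p assume p: "p < length cs"
    define y where "y q = (if q < length cs then x $ var b q else 1)" for q
    have "y q * y (Suc q) = 1 + cs ! q * (x $ var b 0)\<^sup>2" if q: "q < length cs" for q
      using eq[of "var b q"] b q
      by (auto simp: y_def next_coord_def linked_var succ_var coeff_at_var block_var)
    then have "y p = alt_quotient (drop p cs) (x $ var b 0)"
      using p by (intro alt_quotient_chain[OF pos]) (auto simp: y_def)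
    then show "x $ var b p = alt_quotient (drop p cs) (x $ var b 0)"
      using p by (simp add: y_def)
  qed
  show ?others
  proof (intro allI impI)
    fix i assume "k \<le> block i"
    then show "x $ i = 1" using eq[of i] by (simp add: next_coord_def linked_def coeff_at_def)
  qed
next
  assume *: "?blocks \<and> ?others"
  have pos': "\<forall>c\<in>set (drop q cs). 0 < c" for q
    using pos by (meson in_set_dropD)
  have "0 < x $ i \<and> poly_eval (chain_system i) x = 0" for i
  proof (cases i rule: block_cases)
    case (in_block b p)
    have "alt_quotient (drop p cs) s * alt_quotient (drop (Suc p) cs) s = 1 + cs ! p * s\<^sup>2" for s
      using alt_quotient_Cons_mult[OF pos'[of "Suc p"]] in_block(2) by (metis Cons_nth_drop_Suc)
    moreover have "x $ var b p = alt_quotient (drop p cs) (x $ var b 0)"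
      using * in_block by blast
    moreover have "next_coord x (var b p) = alt_quotient (drop (Suc p) cs) (x $ var b 0)"
      using * in_block by (auto simp: next_coord_def linked_var succ_var)
    ultimately show ?thesis
      using alt_quotient_pos[OF pos'[of p]] in_block
      by (simp add: poly_eval_chain_system coeff_at_var block_var)
  next
    case outside
    then show ?thesis
      using * by (simp add: poly_eval_chain_system next_coord_def linked_def coeff_at_def)
  qed
  then show "positive_solution chain_system x"
    by (simp add: positive_solution_def)
qed

text \<open>
  A positive solution amounts to an independent choice of a positive fixed point for each of the \<open>k\<close>
  chains.
\<close>

lemma card_positive_solutions:
  "card {x. positive_solution chain_system x} = card {s. 0 < s \<and> alt_quotient cs s = s} ^ k"
proof -
  let ?R = "{s. 0 < s \<and> alt_quotient cs s = s}"
  define sol :: "(nat \<Rightarrow> real) \<Rightarrow> real ^ 'n" where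
    "sol s = (\<chi> i. if block i < k then alt_quotient (drop (place i) cs) (s (block i)) else 1)" for s
  have sol_head: "sol s $ var b 0 = s b" if "s \<in> {..<k} \<rightarrow>\<^sub>E ?R" "b < k" for s b
  proof -
    have "s b \<in> ?R" using PiE_mem[OF that(1)] that(2) by simp
    then show ?thesis using that(2) nonempty by (simp add: sol_def block_var place_var)
  qed
  have "inj_on sol ({..<k} \<rightarrow>\<^sub>E ?R)"
  proof (rule inj_onI)
    fix s s' assume s: "s \<in> {..<k} \<rightarrow>\<^sub>E ?R" "s' \<in> {..<k} \<rightarrow>\<^sub>E ?R" "sol s = sol s'"
    show "s = s'"
    proof (rule PiE_ext[OF s(1,2)])
      fix b assume "b \<in> {..<k}"
      then show "s b = s' b"
        using sol_head[OF s(1), of b] sol_head[OF s(2), of b] s(3) by simp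
    qed
  qed
  moreover have "{x. positive_solution chain_system x} = sol ` ({..<k} \<rightarrow>\<^sub>E ?R)"
  proof (intro equalityI subsetI)
    fix x assume "x \<in> {x. positive_solution chain_system x}"
    then have "positive_solution chain_system x" by simp
    then have x: "\<And>b. b < k \<Longrightarrow> 0 < x $ var b 0"
        "\<And>b p. b < k \<Longrightarrow> p < length cs \<Longrightarrow> x $ var b p = alt_quotient (drop p cs) (x $ var b 0)"
        "\<And>i. k \<le> block i \<Longrightarrow> x $ i = 1"
      unfolding positive_solution_chain_system_iff by blast+
    have "alt_quotient cs (x $ var b 0) = x $ var b 0" if "b < k" for b
      using x(2)[OF that, of 0] nonempty by (metis drop0 length_greater_0_conv)
    then have "(\<lambda>b\<in>{..<k}. x $ var b 0) \<in> {..<k} \<rightarrow>\<^sub>E ?R"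
      using x(1) by simp
    moreover have "x $ i = sol (\<lambda>b\<in>{..<k}. x $ var b 0) $ i" for i
    proof (cases i rule: block_cases)
      case (in_block b p)
      show ?thesis using x(2)[OF in_block(1,2)] in_block(1,2) by (simp only: in_block(3)) (simp add: sol_def block_var place_var)
    qed (simp add: sol_def x(3))
    ultimately show "x \<in> sol ` ({..<k} \<rightarrow>\<^sub>E ?R)"
      unfolding image_iff vec_eq_iff by blast
  next
    fix x assume "x \<in> sol ` ({..<k} \<rightarrow>\<^sub>E ?R)"
    then obtain s where s: "s \<in> {..<k} \<rightarrow>\<^sub>E ?R" and x: "x = sol s" by blast
    have "0 < sol s $ var b 0" if "b < k" for b
      using PiE_mem[OF s, of b] that by (simp add: sol_head[OF s])
    moreover have "sol s $ var b p = alt_quotient (drop p cs) (sol s $ var b 0)"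
      if "b < k" "p < length cs" for b p
      using that by (simp only: sol_head[OF s]) (simp add: sol_def block_var place_var)
    moreover have "sol s $ i = 1" if "k \<le> block i" for i using that by (simp add: sol_def)
    ultimately show "x \<in> {x. positive_solution chain_system x}"
      unfolding x mem_Collect_eq positive_solution_chain_system_iff by blast
  qed
  ultimately show ?thesis
    by (simp add: card_image card_funcsetE)
qed

lemma jacobian_chain_system:
  "(jacobian (system_map chain_system) (at x) *v h) $ i
    = h $ i * next_coord x i + x $ i * (if linked i then h $ succ i else 0)
      - 2 * coeff_at i * x $ var (block i) 0 * h $ var (block i) 0"
proof -
  have "(system_map chain_system has_derivative (*v) (jacobian (system_map chain_system) (at x))) (at x)"
    using system_map_differentiable jacobian_works by blast
  from bounded_linear.has_derivative[OF bounded_linear_vec_nth[of i] this]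
  have jacobian: "(poly_eval (chain_system i) has_derivative
      (\<lambda>h. (jacobian (system_map chain_system) (at x) *v h) $ i)) (at x)"
    by (simp add: system_map_def)
  have nth: "((\<lambda>x. x $ j) has_derivative (\<lambda>h. h $ j)) (at x)" for j :: 'n
    by (rule bounded_linear_imp_has_derivative) (rule bounded_linear_vec_nth)
  have coord: "((\<lambda>x. next_coord x i) has_derivative (\<lambda>h. if linked i then h $ succ i else 0)) (at x)"
    by (cases "linked i") (simp_all add: next_coord_def nth)
  have explicit: "(poly_eval (chain_system i) has_derivative
      (\<lambda>h. h $ i * next_coord x i + x $ i * (if linked i then h $ succ i else 0)
      - 2 * coeff_at i * x $ var (block i) 0 * h $ var (block i) 0)) (at x)"
    unfolding poly_eval_chain_system[abs_def]
    by (rule derivative_eq_intros nth coord refl)+ (simp add: algebra_simps)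
  show ?thesis
    using fun_cong[OF has_derivative_unique[OF jacobian explicit], of h] .
qed

text \<open>
  A kernel vector of the Jacobian satisfies the linearized chain equations, so on each chain it is
  determined by its entry \<open>w\<close> at the first variable. There it must agree with
  \<open>w * deriv (alt_quotient cs) s\<close>, which forces \<open>w = 0\<close>.
\<close>

lemma nondegenerate_chain_system:
  assumes sol: "positive_solution chain_system x"
    and simple: "\<And>s. alt_quotient cs s = s \<Longrightarrow> deriv (alt_quotient cs) s \<noteq> 1"
  shows "nondegenerate chain_system x"
proof -
  let ?J = "jacobian (system_map chain_system) (at x)"
  have x: "\<And>b p. b < k \<Longrightarrow> p < length cs \<Longrightarrow> x $ var b p = alt_quotient (drop p cs) (x $ var b 0)"
      "\<And>i. k \<le> block i \<Longrightarrow> x $ i = 1"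
    using sol unfolding positive_solution_chain_system_iff by blast+
  have "h = 0" if "?J *v h = 0" for h
  proof -
    have eq: "h $ i * next_coord x i + x $ i * (if linked i then h $ succ i else 0)
        = 2 * coeff_at i * x $ var (block i) 0 * h $ var (block i) 0" for i
      using jacobian_chain_system[of x h i] that by simp
    have "h $ i = 0" for i
    proof (cases i rule: block_cases)
      case (in_block b p)
      let ?s = "x $ var b 0" and ?w = "h $ var b 0"
      define v where "v q = (if q < length cs then h $ var b q else 0)" for q
      have v: "v q = ?w * deriv (alt_quotient (drop q cs)) ?s" if "q \<le> length cs" for q
      proof (rule alt_quotient_chain_tangent[OF pos _ _ that])
        show "v (length cs) = 0" by (simp add: v_def)
        fix q assume q: "q < length cs"
        have "next_coord x (var b q) = alt_quotient (drop (Suc q) cs) ?s"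
          using x(1)[OF in_block(1), of "Suc q"] in_block(1) q
          by (cases "Suc q < length cs") (simp_all add: next_coord_def linked_var succ_var)
        then show "v q * alt_quotient (drop (Suc q) cs) ?s
            + alt_quotient (drop q cs) ?s * v (Suc q) = 2 * cs ! q * ?s * ?w"
          using eq[of "var b q"] in_block(1) q
          unfolding x(1)[OF in_block(1) q, symmetric] v_def
          by (cases "Suc q < length cs") (simp_all add: linked_var succ_var coeff_at_var block_var)
      qed
      have "?w = ?w * deriv (alt_quotient cs) ?s"
        using v[of 0] nonempty by (simp add: v_def)
      moreover have "alt_quotient cs ?s = ?s"
        using x(1)[OF in_block(1), of 0] nonempty by (metis drop0 length_greater_0_conv)
      then have "deriv (alt_quotient cs) ?s \<noteq> 1" by (rule simple)
      ultimately have "?w = 0" by (metis mult_cancel_left2)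
      then show ?thesis using v[of p] in_block by (simp add: v_def)
    next
      case outside
      then show ?thesis using eq[of i] by (simp add: next_coord_def linked_def coeff_at_def)
    qed
    then show ?thesis by (simp add: vec_eq_iff)
  qed
  then show ?thesis
    unfolding nondegenerate_def invertible_left_inverse matrix_left_invertible_ker by blast
qed

end

lemma exists_chain_blocks:
  assumes "k * length cs \<le> CARD('n::finite)" "cs \<noteq> []" "\<forall>c\<in>set cs. 0 < c"
  shows "\<exists>(var :: nat \<Rightarrow> nat \<Rightarrow> 'n) block place. chain_blocks k cs var block place"
proof -
  let ?m = "length cs"
  obtain g :: "nat \<Rightarrow> 'n" where g: "bij_betw g {0..<CARD('n)} UNIV"
    using ex_bij_betw_nat_finite[of "UNIV :: 'n set"] by auto
  define idx where "idx = inv_into {0..<CARD('n)} g"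
  have idx_g: "idx (g j) = j" if "j < CARD('n)" for j
    using bij_betw_inv_into_left[OF g] that by (simp add: idx_def)
  have g_idx: "g (idx i) = i" for i
    using bij_betw_inv_into_right[OF g] by (simp add: idx_def)
  have bound: "b * ?m + p < CARD('n)" if "b < k" "p < ?m" for b p
  proof -
    have "b * ?m + p < Suc b * ?m" using that by simp
    also have "\<dots> \<le> k * ?m" using that by (intro mult_le_mono1) simp
    finally show ?thesis using assms(1) by simp
  qed
  \<comment> \<open>Enumerate the variables and cut the enumeration into intervals of length \<open>?m\<close>.\<close>
  have "chain_blocks k cs (\<lambda>b p. g (b * ?m + p)) (\<lambda>i. idx i div ?m) (\<lambda>i. idx i mod ?m)"
    by unfold_locales (use assms in \<open>auto simp: idx_g bound g_idx\<close>)
  then show ?thesis by blast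
qed

theorem theorem1:
  fixes n k :: nat
  assumes "CARD('n::finite) = n" and "k > 0" and "n > k"
  shows "\<exists>f :: 'n \<Rightarrow> 'n rpoly.
           card (system_monomials f) = n + k + 1 \<and>
           card {x. positive_solution f x \<and> nondegenerate f x} = ((n + k) div k) ^ k"
proof -
  obtain cs where len: "length cs = n div k" and pos: "\<forall>c\<in>set cs. 0 < c"
    and count: "card {s. 0 < s \<and> alt_quotient cs s = s} = Suc (n div k)"
    and simple: "\<And>s. alt_quotient cs s = s \<Longrightarrow> deriv (alt_quotient cs) s \<noteq> 1"
    using exists_chain_coefficients[of "n div k"] by blast
  have "0 < n div k" using assms by (simp add: div_greater_zero_iff)
  then have "cs \<noteq> []" using len by auto
  moreover have "k * length cs \<le> CARD('n)" using assms(1) len by simp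
  ultimately obtain var :: "nat \<Rightarrow> nat \<Rightarrow> 'n" and block place where "chain_blocks k cs var block place"
    using exists_chain_blocks pos by blast
  then interpret chain_blocks k cs var block place .
  have "{x. positive_solution chain_system x \<and> nondegenerate chain_system x}
      = {x. positive_solution chain_system x}"
    using nondegenerate_chain_system simple by blast
  then have "card {x. positive_solution chain_system x \<and> nondegenerate chain_system x}
      = ((n + k) div k) ^ k"
    using card_positive_solutions count \<open>k > 0\<close> by simp
  then show ?thesis
    using card_system_monomials assms(1) by blast
qed

end
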